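(* Let $\lambda\in\mathbb{R}$, let $\alpha$ be a positive integer, let $m\in\mathbb{N}$ with $m\ge \alpha$, and let $a_1,a_2,\dots,a_m$ be any (complex) sequence. Then \[ \sum_{k=\alpha}^{m}(k)_{\alpha,\lambda}\,a_{k}=\sum_{k=1}^{m}S_{2,\lambda}(\alpha,k)\,k!\sum_{l=k}^{m}\binom{l}{k}a_{l}\;-\;\sum_{k=1}^{\alpha-1}S_{2,\lambda}(\alpha,k)\,k!\sum_{l=k}^{\alpha-1}\binom{l}{k}a_{l}. \]
   Context: For $\lambda\in\mathbb{R}$, the generalized falling factorial polynomials are $(x)_{0,\lambda}=1$ and $(x)_{n,\lambda}=x(x-\lambda)(x-2\lambda)\cdots(x-(n-1)\lambda)$ for $n\ge1$. The ordinary falling factorial is $(x)_0=1$, $(x)_n=x(x-1)\cdots(x-n+1)$ for $n\ge 1$. The degenerate Stirling numbers of the second kind $S_{2,\lambda}(n,k)$ ($0\le k\le n$) are defined by $(x)_{n,\lambda}=\sum_{k=0}^{n}S_{2,\lambda}(n,k)(x)_{k}$ for all $n\ge 0$, with $S_{2,\lambda}(n,k)=0$ for $k>n$ or $k<0$. *)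

theory Defs
  imports Complex_Main
begin

definition gen_ffact :: "real \<Rightarrow> nat \<Rightarrow> real \<Rightarrow> real" where
  "gen_ffact lam n x = (\<Prod>i<n. x - real i * lam)"

definition ffact :: "nat \<Rightarrow> real \<Rightarrow> real" where
  "ffact n x = (\<Prod>i<n. x - real i)"

text \<open>The coefficient family of the expansion of the generalized falling factorial in the
  falling factorial basis; it is well defined by \<open>deg_Stirling2_ex1\<close> below.\<close>

definition deg_Stirling2 :: "real \<Rightarrow> nat \<Rightarrow> nat \<Rightarrow> real" where
  "deg_Stirling2 lam n =
    (THE s. (\<forall>x. gen_ffact lam n x = (\<Sum>k=0..n. s k * ffact k x)) \<and> (\<forall>k>n. s k = 0))"

lemma gen_ffact_expansion_ex:
  "\<exists>s. (\<forall>x. gen_ffact lam n x = (\<Sum>k=0..n. s k * ffact k x)) \<and> (\<forall>k>n. s k = 0)"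
proof (induction n)
  case 0
  show ?case
    by (rule exI[of _ "\<lambda>k. if k = 0 then 1 else 0"]) (simp add: gen_ffact_def ffact_def)
next
  case (Suc n)
  then obtain s where s: "\<And>x. gen_ffact lam n x = (\<Sum>k=0..n. s k * ffact k x)"
    and s0: "\<And>k. k > n \<Longrightarrow> s k = 0" by blast
  define t where
    "t k = (case k of 0 \<Rightarrow> 0 | Suc j \<Rightarrow> s j) + (real k - real n * lam) * s k" for k
  have "gen_ffact lam (Suc n) x = (\<Sum>k=0..Suc n. t k * ffact k x)" for x
  proof -
    have "gen_ffact lam (Suc n) x = (\<Sum>k=0..n. s k * ffact k x) * (x - real n * lam)"
      by (simp add: gen_ffact_def flip: s)
    also have "\<dots> = (\<Sum>k=0..n. s k * ffact (Suc k) x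
        + (real k - real n * lam) * s k * ffact k x)"
      unfolding sum_distrib_right by (rule sum.cong) (simp_all add: ffact_def algebra_simps)
    also have "\<dots> = (\<Sum>k=0..n. s k * ffact (Suc k) x)
        + (\<Sum>k=0..n. (real k - real n * lam) * s k * ffact k x)"
      by (simp add: sum.distrib)
    also have "(\<Sum>k=0..n. s k * ffact (Suc k) x)
        = (\<Sum>k=0..Suc n. (case k of 0 \<Rightarrow> 0 | Suc j \<Rightarrow> s j) * ffact k x)"
      by (subst sum.atLeast0_atMost_Suc_shift) (simp add: comp_def)
    also have "(\<Sum>k=0..n. (real k - real n * lam) * s k * ffact k x)
        = (\<Sum>k=0..Suc n. (real k - real n * lam) * s k * ffact k x)"
      by (simp add: s0)
    finally show ?thesis
      by (simp only: t_def distrib_right sum.distrib)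
  qed
  moreover have "t k = 0" if "k > Suc n" for k
    using that by (auto simp: t_def s0 split: nat.split)
  ultimately show ?case by blast
qed

lemma ffact_of_nat_eq_0: "j < k \<Longrightarrow> ffact k (real j) = 0"
  by (auto simp: ffact_def)

lemma ffact_self_neq_0: "ffact j (real j) \<noteq> 0"
  by (auto simp: ffact_def)

lemma ffact_expansion_unique:
  assumes "\<And>x. (\<Sum>k=0..n. s k * ffact k x) = (\<Sum>k=0..n. t k * ffact k x)"
    and "k \<le> n"
  shows "s k = t k"
  using assms(2)
proof (induction k rule: less_induct)
  case (less j)
  have *: "(\<Sum>k=0..n. u k * ffact k (real j)) = (\<Sum>k<j. u k * ffact k (real j)) + u j * ffact j (real j)"
    for u
  proof -
    have "(\<Sum>k=0..n. u k * ffact k (real j)) = (\<Sum>k<Suc j. u k * ffact k (real j))"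
      using less.prems by (intro sum.mono_neutral_right) (auto simp: ffact_of_nat_eq_0)
    then show ?thesis by simp
  qed
  have "(\<Sum>k<j. s k * ffact k (real j)) = (\<Sum>k<j. t k * ffact k (real j))"
    using less by (intro sum.cong) auto
  then show ?case
    using assms(1)[of "real j"] ffact_self_neq_0[of j] by (simp add: *)
qed

lemma deg_Stirling2_ex1:
  "\<exists>!s. (\<forall>x. gen_ffact lam n x = (\<Sum>k=0..n. s k * ffact k x)) \<and> (\<forall>k>n. s k = 0)"
proof (rule ex_ex1I[OF gen_ffact_expansion_ex])
  fix s t
  assume s: "(\<forall>x. gen_ffact lam n x = (\<Sum>k=0..n. s k * ffact k x)) \<and> (\<forall>k>n. s k = 0)"
    and t: "(\<forall>x. gen_ffact lam n x = (\<Sum>k=0..n. t k * ffact k x)) \<and> (\<forall>k>n. t k = 0)"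
  show "s = t"
  proof
    fix k
    show "s k = t k"
    proof (cases "k \<le> n")
      case True
      with s t show ?thesis by (intro ffact_expansion_unique[where n = n and s = s and t = t and k = k]) auto
    next
      case False
      with s t show ?thesis by simp
    qed
  qed
qed

lemma gen_ffact_eq_sum_deg_Stirling2:
  "gen_ffact lam n x = (\<Sum>k=0..n. deg_Stirling2 lam n k * ffact k x)"
  using theI'[OF deg_Stirling2_ex1[of lam n]] unfolding deg_Stirling2_def by blast

lemma deg_Stirling2_eq_0: "k > n \<Longrightarrow> deg_Stirling2 lam n k = 0"
  using theI'[OF deg_Stirling2_ex1[of lam n]] unfolding deg_Stirling2_def by blast

end

theory Submission
  imports Defs
begin

text \<open>At a natural number l the falling factorial of order k is k! times the binomial
  coefficient (\<open>ffact_of_nat\<close>), so the defining expansion becomes a combination of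
  binomials in l (\<open>gen_ffact_of_nat\<close>). Weighting it by a_l, summing over 1 \<le> l
  \<le> N and interchanging the sums turns each double sum of the claim into a plain sum of
  generalized falling factorials (\<open>sum_gen_ffact_mult\<close>). The right-hand side is the
  difference of these for N = m and N = \<alpha> - 1, which leaves exactly the indices from \<alpha>
  to m.\<close>

lemma ffact_of_nat: "ffact k (real l) = fact k * real (l choose k)"
  by (simp add: ffact_def binomial_gbinomial gbinomial_prod_rev lessThan_atLeast0)

text \<open>Evaluate the expansion at x = 0: the left side has the factor x, and on the right only
  the term k = 0 survives. This lets sums over k start at 1.\<close>

lemma deg_Stirling2_0_right:
  assumes "n \<ge> 1"
  shows "deg_Stirling2 lam n 0 = 0"
proof -
  have "gen_ffact lam n 0 = 0"
    using assms by (auto simp: gen_ffact_def intro!: bexI[of _ 0])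
  moreover have "(\<Sum>k=0..n. deg_Stirling2 lam n k * ffact k 0) = deg_Stirling2 lam n 0"
    using ffact_of_nat[of _ 0] by (simp add: sum.atLeast_Suc_atMost binomial_eq_0)
  ultimately show ?thesis
    using gen_ffact_eq_sum_deg_Stirling2[of lam n 0] by simp
qed

text \<open>The bound \<open>N\<close> is independent of \<open>l\<close> and of \<open>n\<close>,
  so that one range of k serves all l \<le> N when the sums are interchanged.\<close>

lemma gen_ffact_of_nat:
  assumes "n \<ge> 1" and "l \<le> N"
  shows "gen_ffact lam n (real l)
    = (\<Sum>k=1..N. deg_Stirling2 lam n k * fact k * real (l choose k))"
proof -
  let ?f = "\<lambda>k. deg_Stirling2 lam n k * fact k * real (l choose k)"
  have "gen_ffact lam n (real l) = sum ?f {0..n}"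
    by (simp add: gen_ffact_eq_sum_deg_Stirling2[of lam n] ffact_of_nat mult.assoc)
  \<comment> \<open>\<open>{0..n + N}\<close> contains both ranges. Terms with k > n have zero
    Stirling number; on the way down, k = 0 drops out because n \<ge> 1, and k > N because then k >
    l and the binomial is zero.\<close>
  also have "\<dots> = sum ?f {0..n + N}"
    by (rule sum.mono_neutral_left) (auto simp: deg_Stirling2_eq_0)
  also have "\<dots> = sum ?f {1..N}"
    using assms
    by (intro sum.mono_neutral_right)
      (auto simp: deg_Stirling2_0_right binomial_eq_0 not_less_eq_eq)
  finally show ?thesis .
qed

lemma sum_gen_ffact_mult:
  fixes a :: "nat \<Rightarrow> complex"
  assumes "n \<ge> 1"
  shows "(\<Sum>k=1..N. of_real (deg_Stirling2 lam n k) * fact k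
      * (\<Sum>l=k..N. of_nat (l choose k) * a l))
    = (\<Sum>l=1..N. of_real (gen_ffact lam n (real l)) * a l)"
proof -
  let ?c = "\<lambda>k. of_real (deg_Stirling2 lam n k) * fact k :: complex"
  \<comment> \<open>The binomial vanishes for l < k, so the triangular range of summation can be
    filled up to a square, where the sums swap freely.\<close>
  have "(\<Sum>k=1..N. ?c k * (\<Sum>l=k..N. of_nat (l choose k) * a l))
      = (\<Sum>k=1..N. ?c k * (\<Sum>l=1..N. of_nat (l choose k) * a l))"
    by (intro sum.cong refl arg_cong2[where f = "(*)"] sum.mono_neutral_left) auto
  also have "\<dots> = (\<Sum>k=1..N. \<Sum>l=1..N. ?c k * of_nat (l choose k) * a l)"
    by (simp add: sum_distrib_left mult.assoc)
  also have "\<dots> = (\<Sum>l=1..N. \<Sum>k=1..N. ?c k * of_nat (l choose k) * a l)"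
    by (rule sum.swap)
  also have "\<dots> = (\<Sum>l=1..N. of_real (gen_ffact lam n (real l)) * a l)"
    by (intro sum.cong refl)
      (simp add: gen_ffact_of_nat[OF assms, of _ N] flip: sum_distrib_right)
  finally show ?thesis .
qed

theorem theorem1:
  fixes lam :: real and \<alpha> m :: nat and a :: "nat \<Rightarrow> complex"
  assumes "\<alpha> \<ge> 1" and "m \<ge> \<alpha>"
  shows "(\<Sum>k=\<alpha>..m. of_real (gen_ffact lam \<alpha> (real k)) * a k) =
    (\<Sum>k=1..m. of_real (deg_Stirling2 lam \<alpha> k) * fact k * (\<Sum>l=k..m. of_nat (l choose k) * a l))
    - (\<Sum>k=1..\<alpha>-1. of_real (deg_Stirling2 lam \<alpha> k) * fact k
        * (\<Sum>l=k..\<alpha>-1. of_nat (l choose k) * a l))"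
proof -
  let ?g = "\<lambda>k. of_real (gen_ffact lam \<alpha> (real k)) * a k"
  \<comment> \<open>As \<alpha> \<ge> 1, the natural subtraction is exact and the second block omits
    0; the first block is empty when \<alpha> = 1.\<close>
  have "{1..m} = {1..\<alpha>-1} \<union> {\<alpha>..m}"
    using assms by auto
  then have "sum ?g {1..m} = sum ?g {1..\<alpha>-1} + sum ?g {\<alpha>..m}"
    by (simp only:) (rule sum.union_disjoint, auto)
  then show ?thesis
    by (simp only: sum_gen_ffact_mult[OF assms(1)]) simp
qed

end
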